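(* Let $e \ge 4$ and $r \ge 0$ be integers, and let $s$ be an integer with $0 \le s \le \min(e-2, r)$. Then there exists a numerical semigroup $S$ with embedding dimension $e$ and multiplicity $m = r + e$ such that $\eta(S) = \binom{e}{2} - s$.
   Context: A numerical semigroup is a cofinite subset $S \subseteq \mathbb{Z}_{\ge 0}$ containing $0$ and closed under addition. It has a unique minimal generating set $n_1 < \cdots < n_e$; $e$ is the embedding dimension and $n_1$ the multiplicity. The factorization homomorphism $\varphi_S:\mathbb{Z}_{\ge 0}^e \to S$, $z \mapsto \sum z_in_i$, has kernel the congruence $\ker\varphi_S = \{(z,z') : \varphi_S(z) = \varphi_S(z')\}$. A presentation of $S$ is a subset $\rho \subseteq \ker\varphi_S$ such that the smallest congruence containing $\rho$ is $\ker\varphi_S$; it is minimal if no proper subset is a presentation. All minimal presentations have the same cardinality, denoted $\eta(S)$. *)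

theory Defs
  imports Complex_Main
begin

section \<open>Numerical semigroups\<close>

definition numerical_semigroup :: "nat set \<Rightarrow> bool" where
  "numerical_semigroup S \<longleftrightarrow>
     finite (- S) \<and> 0 \<in> S \<and> (\<forall>a\<in>S. \<forall>b\<in>S. a + b \<in> S)"

inductive_set generated_submonoid :: "nat set \<Rightarrow> nat set" for A :: "nat set" where
  zero: "0 \<in> generated_submonoid A"
| gen: "a \<in> A \<Longrightarrow> a \<in> generated_submonoid A"
| add: "a \<in> generated_submonoid A \<Longrightarrow> b \<in> generated_submonoid A
          \<Longrightarrow> a + b \<in> generated_submonoid A"

definition minimal_generating_set :: "nat set \<Rightarrow> nat set \<Rightarrow> bool" where
  "minimal_generating_set S A \<longleftrightarrow>
     generated_submonoid A = S \<and> (\<forall>B. B \<subset> A \<longrightarrow> generated_submonoid B \<noteq> S)"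

text \<open>The description is proper by \<open>ex1_minimal_generating_set\<close> below, and the set is
  finite by \<open>finite_min_gens\<close>.\<close>

definition min_gens :: "nat set \<Rightarrow> nat set" where
  "min_gens S = (THE A. minimal_generating_set S A)"

definition embedding_dim :: "nat set \<Rightarrow> nat" where
  "embedding_dim S = card (min_gens S)"

definition semigroup_multiplicity :: "nat set \<Rightarrow> nat" where
  "semigroup_multiplicity S = Min (min_gens S)"

text \<open>The generators in increasing order, indexed from \<open>0\<close>: \<open>nth_gen S i\<close> is
  $n_{i+1}$.\<close>

definition nth_gen :: "nat set \<Rightarrow> nat \<Rightarrow> nat" where
  "nth_gen S i = sorted_list_of_set (min_gens S) ! i"


section \<open>Presentations\<close>

text \<open>The monoid $\mathbb{Z}_{\ge 0}^e$, encoded as the functions vanishing outside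
  \<open>{..<e}\<close>, with pointwise addition.\<close>

definition nat_vectors :: "nat \<Rightarrow> (nat \<Rightarrow> nat) set" where
  "nat_vectors e = {z. \<forall>i\<ge>e. z i = 0}"

definition factorization_hom :: "nat set \<Rightarrow> (nat \<Rightarrow> nat) \<Rightarrow> nat" where
  "factorization_hom S z = (\<Sum>i<embedding_dim S. z i * nth_gen S i)"

definition factorization_kernel :: "nat set \<Rightarrow> ((nat \<Rightarrow> nat) \<times> (nat \<Rightarrow> nat)) set" where
  "factorization_kernel S =
     {(z, z'). z \<in> nat_vectors (embedding_dim S) \<and> z' \<in> nat_vectors (embedding_dim S) \<and>
               factorization_hom S z = factorization_hom S z'}"

definition monoid_congruence :: "nat \<Rightarrow> ((nat \<Rightarrow> nat) \<times> (nat \<Rightarrow> nat)) set \<Rightarrow> bool" where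
  "monoid_congruence e R \<longleftrightarrow>
     equiv (nat_vectors e) R \<and>
     (\<forall>z z' w. (z, z') \<in> R \<longrightarrow> w \<in> nat_vectors e \<longrightarrow>
        ((\<lambda>i. z i + w i), (\<lambda>i. z' i + w i)) \<in> R)"

definition generated_congruence ::
  "nat \<Rightarrow> ((nat \<Rightarrow> nat) \<times> (nat \<Rightarrow> nat)) set \<Rightarrow> ((nat \<Rightarrow> nat) \<times> (nat \<Rightarrow> nat)) set" where
  "generated_congruence e \<rho> = \<Inter> {R. monoid_congruence e R \<and> \<rho> \<subseteq> R}"

definition is_presentation :: "nat set \<Rightarrow> ((nat \<Rightarrow> nat) \<times> (nat \<Rightarrow> nat)) set \<Rightarrow> bool" where
  "is_presentation S \<rho> \<longleftrightarrow>
     \<rho> \<subseteq> factorization_kernel S \<and>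
     generated_congruence (embedding_dim S) \<rho> = factorization_kernel S"

definition minimal_presentation :: "nat set \<Rightarrow> ((nat \<Rightarrow> nat) \<times> (nat \<Rightarrow> nat)) set \<Rightarrow> bool" where
  "minimal_presentation S \<rho> \<longleftrightarrow>
     is_presentation S \<rho> \<and> (\<forall>\<sigma>. \<sigma> \<subset> \<rho> \<longrightarrow> \<not> is_presentation S \<sigma>)"

text \<open>The common cardinality of all minimal presentations. Uniqueness of \<open>k\<close> forces a
  minimal presentation to exist, since otherwise every \<open>k\<close> would qualify.\<close>

definition eta :: "nat set \<Rightarrow> nat" where
  "eta S = (THE k. \<forall>\<rho>. minimal_presentation S \<rho> \<longrightarrow> finite \<rho> \<and> card \<rho> = k)"


section \<open>The minimal generating set\<close>

lemma generated_submonoid_mono: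
  "A \<subseteq> B \<Longrightarrow> generated_submonoid A \<subseteq> generated_submonoid B"
proof
  fix x assume AB: "A \<subseteq> B" and "x \<in> generated_submonoid A"
  from this(2) show "x \<in> generated_submonoid B"
    by induction (use AB in \<open>auto intro: generated_submonoid.intros\<close>)
qed

lemma generated_submonoid_subset:
  assumes "numerical_semigroup S" "A \<subseteq> S"
  shows "generated_submonoid A \<subseteq> S"
proof
  fix x assume "x \<in> generated_submonoid A"
  then show "x \<in> S"
    by induction (use assms in \<open>auto simp: numerical_semigroup_def\<close>)
qed

definition irreducibles :: "nat set \<Rightarrow> nat set" where
  "irreducibles S = {x \<in> S. x \<noteq> 0 \<and> (\<forall>a\<in>S. \<forall>b\<in>S. x = a + b \<longrightarrow> a = 0 \<or> b = 0)}"

lemma generated_by_irreducibles: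
  assumes "numerical_semigroup S"
  shows "generated_submonoid (irreducibles S) = S"
proof
  show "generated_submonoid (irreducibles S) \<subseteq> S"
    by (rule generated_submonoid_subset[OF assms]) (auto simp: irreducibles_def)
  have "x \<in> S \<Longrightarrow> x \<in> generated_submonoid (irreducibles S)" for x
  proof (induction x rule: less_induct)
    case (less x)
    show ?case
    proof (cases "x = 0 \<or> x \<in> irreducibles S")
      case True
      then show ?thesis by (auto intro: generated_submonoid.intros)
    next
      case False
      then obtain a b where ab: "a \<in> S" "b \<in> S" "x = a + b" "a \<noteq> 0" "b \<noteq> 0"
        using less.prems by (auto simp: irreducibles_def)
      then show ?thesis
        using less.IH[of a] less.IH[of b] by (auto intro: generated_submonoid.add)
    qed
  qed
  then show "S \<subseteq> generated_submonoid (irreducibles S)" by blast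
qed

lemma irreducibles_subset_generators:
  assumes gen: "generated_submonoid A = S"
  shows "irreducibles S \<subseteq> A"
proof
  fix x assume x: "x \<in> irreducibles S"
  have "y \<in> generated_submonoid A \<Longrightarrow> y \<in> irreducibles S \<Longrightarrow> y \<in> A" for y
  proof (induction rule: generated_submonoid.induct)
    case (add a b)
    then have "a = 0 \<or> b = 0" using gen by (auto simp: irreducibles_def)
    then show ?case using add by auto
  qed (auto simp: irreducibles_def)
  then show "x \<in> A" using x gen by (auto simp: irreducibles_def)
qed

lemma minimal_generating_set_iff:
  assumes "numerical_semigroup S"
  shows "minimal_generating_set S A \<longleftrightarrow> A = irreducibles S"
  using generated_by_irreducibles[OF assms] irreducibles_subset_generators
  unfolding minimal_generating_set_def by (metis psubsetI psubset_eq subset_antisym)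

lemma ex1_minimal_generating_set:
  "numerical_semigroup S \<Longrightarrow> \<exists>!A. minimal_generating_set S A"
  by (simp add: minimal_generating_set_iff)

lemma min_gens_eq_irreducibles:
  "numerical_semigroup S \<Longrightarrow> min_gens S = irreducibles S"
  by (simp add: min_gens_def minimal_generating_set_iff)

lemma finite_min_gens:
  assumes S: "numerical_semigroup S"
  shows "finite (min_gens S)"
proof -
  have "infinite S"
    using S by (metis numerical_semigroup_def finite_compl infinite_UNIV_nat)
  then obtain m where m: "m \<in> S" "m \<noteq> 0"
    by (metis finite.simps finite_subset insertCI subsetI)
  have fin: "finite ((\<lambda>g. m + g) ` (- S))"
    using S by (simp add: numerical_semigroup_def)
  have "irreducibles S \<subseteq> {..m} \<union> (\<lambda>g. m + g) ` (- S)"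
  proof
    fix x assume x: "x \<in> irreducibles S"
    show "x \<in> {..m} \<union> (\<lambda>g. m + g) ` (- S)"
    proof (cases "x \<le> m")
      case False
      then have "x = m + (x - m)" "x - m \<noteq> 0" by auto
      moreover from this have "x - m \<notin> S"
        using x m unfolding irreducibles_def by (metis (mono_tags, lifting) mem_Collect_eq)
      ultimately show ?thesis by blast
    qed simp
  qed
  then show ?thesis
    using fin by (simp add: min_gens_eq_irreducibles[OF S] finite_subset)
qed

end

theory Submission
  imports Defs "HOL-Library.Multiset"
begin

text \<open>Call two factorizations of the same element linked if they share an atom. A presentation has
  to connect the components of the linking graph in every fibre of the factorization homomorphism,
  so a minimal one is a spanning forest on these components, and \<open>\<eta>\<close> counts the components beyond
  the first one of each fibre.

  For \<open>s = k + 1\<close> take the atoms \<open>m, z, x, y\<^sub>1, \<dots>, y\<^sub>p\<close> with \<open>p = e - 3\<close>, chosen such that the Apery set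
  with respect to \<open>m\<close> consists of \<open>0\<close>, the atoms other than \<open>m\<close>, the multiples \<open>2z, \<dots>, az\<close>, the sum
  \<open>x + z\<close>, which equals \<open>y\<^sub>i + y\<^sub>j\<close> for \<open>i + j = p + 1\<close>, and \<open>x + y\<^sub>1, \<dots>, x + y\<^sub>k\<close>. Then the components
  to be counted are the sums of two atoms other than \<open>m\<close>, except that \<open>x + z\<close> and the \<open>x + y\<^sub>l\<close> with
  \<open>l \<le> k\<close> are lost and \<open>(a + 1)z\<close> replaces \<open>2z\<close>. The relation \<open>x + z + z\<close> costs nothing new because
  it contains \<open>y\<^sub>1 + z\<close> up to the equality with \<open>y\<^sub>1 + y\<^sub>p\<close>. For \<open>s = 0\<close> the atom \<open>x\<close> is dropped.\<close>

section \<open>Presentations and linked factorizations\<close>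

definition linked :: "nat set \<Rightarrow> ((nat \<Rightarrow> nat) \<times> (nat \<Rightarrow> nat)) set" where
  "linked S = {(z, z') \<in> factorization_kernel S. \<exists>i. z i > 0 \<and> z' i > 0}"

lemma nth_gen_pos:
  assumes "numerical_semigroup S" "i < embedding_dim S"
  shows "nth_gen S i > 0"
proof -
  have "nth_gen S i \<in> min_gens S"
    using assms finite_min_gens[OF assms(1)] unfolding nth_gen_def embedding_dim_def
    by (metis nth_mem set_sorted_list_of_set length_sorted_list_of_set)
  then show ?thesis
    using assms by (auto simp: min_gens_eq_irreducibles irreducibles_def)
qed

lemma factorization_hom_add:
  "factorization_hom S (\<lambda>i. z i + w i) = factorization_hom S z + factorization_hom S w"
  by (simp add: factorization_hom_def sum.distrib algebra_simps)

lemma factorization_kernel_congruence: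
  "monoid_congruence (embedding_dim S) (factorization_kernel S)"
  unfolding monoid_congruence_def
  by (auto simp: factorization_kernel_def nat_vectors_def equiv_def refl_on_def sym_def trans_def
      factorization_hom_add)

lemma sym_linked: "sym (linked S)"
  by (auto simp: sym_def linked_def factorization_kernel_def)

lemma linked_add:
  assumes "(z, z') \<in> factorization_kernel S" "w \<in> nat_vectors (embedding_dim S)" "w i > 0"
  shows "((\<lambda>i. z i + w i), (\<lambda>i. z' i + w i)) \<in> linked S"
  using assms by (auto simp: linked_def factorization_kernel_def factorization_hom_add
      nat_vectors_def intro!: exI[of _ i])

lemma steps_in_kernel:
  assumes "(z, z') \<in> (\<rho> \<union> \<rho>\<inverse> \<union> linked S)\<^sup>*" "\<rho> \<subseteq> factorization_kernel S"
    "z \<in> nat_vectors (embedding_dim S)"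
  shows "(z, z') \<in> factorization_kernel S"
  using assms(1)
proof (induction rule: rtrancl_induct)
  case base
  then show ?case using assms(3) by (simp add: factorization_kernel_def)
next
  case (step y z)
  then have "(y, z) \<in> factorization_kernel S"
    using assms(2) by (auto simp: linked_def factorization_kernel_def)
  then show ?case using step.IH by (auto simp: factorization_kernel_def)
qed

text \<open>Translating a kernel pair by a nonzero vector produces a linked pair, so adjoining the linked
  pairs makes every equivalence inside the kernel a congruence. Conversely a linked pair is a
  translate of a kernel pair of smaller value.\<close>

lemma is_presentation_iff:
  assumes S: "numerical_semigroup S"
  shows "is_presentation S \<rho> \<longleftrightarrow> \<rho> \<subseteq> factorization_kernel S \<and>
           factorization_kernel S \<subseteq> (\<rho> \<union> \<rho>\<inverse> \<union> linked S)\<^sup>*"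
    (is "_ \<longleftrightarrow> ?sub \<and> _ \<subseteq> ?E\<^sup>*")
proof (cases ?sub)
  case False
  then show ?thesis by (simp add: is_presentation_def)
next
  case sub: True
  let ?e = "embedding_dim S" and ?K = "factorization_kernel S"
  let ?X = "nat_vectors ?e"
  \<comment> \<open>The restriction to \<open>?X\<close> removes the reflexive pairs of functions
    outside the monoid.\<close>
  define R where "R = {(z, z'). z \<in> ?X \<and> z' \<in> ?X \<and> (z, z') \<in> ?E\<^sup>*}"
  have symE: "sym (?E\<^sup>*)"
    by (intro sym_rtrancl) (use sym_linked[of S] in \<open>auto simp: sym_def\<close>)
  have RK: "R \<subseteq> ?K" using steps_in_kernel[OF _ sub] by (auto simp: R_def)
  have Rcong: "monoid_congruence ?e R"
    unfolding monoid_congruence_def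
  proof (intro conjI allI impI)
    show "equiv ?X R"
      using symE by (auto simp: equiv_def R_def refl_on_def sym_def trans_def)
  next
    fix z z' w assume zz: "(z, z') \<in> R" and w: "w \<in> ?X"
    show "((\<lambda>i. z i + w i), (\<lambda>i. z' i + w i)) \<in> R"
    proof (cases "\<exists>i. w i > 0")
      case True
      then have "((\<lambda>i. z i + w i), (\<lambda>i. z' i + w i)) \<in> linked S"
        using zz RK w linked_add by blast
      then show ?thesis
        by (auto simp: R_def linked_def factorization_kernel_def)
    next
      case False
      then show ?thesis using zz by auto
    qed
  qed
  have \<rho>R: "\<rho> \<subseteq> R" using sub by (auto simp: R_def factorization_kernel_def)
  have gK: "generated_congruence ?e \<rho> \<subseteq> ?K"
    using sub factorization_kernel_congruence[of S] by (auto simp: generated_congruence_def)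
  have "generated_congruence ?e \<rho> = ?K \<longleftrightarrow> ?K \<subseteq> ?E\<^sup>*"
  proof
    assume "generated_congruence ?e \<rho> = ?K"
    then have "?K \<subseteq> R" using Rcong \<rho>R by (auto simp: generated_congruence_def)
    then show "?K \<subseteq> ?E\<^sup>*" by (auto simp: R_def)
  next
    assume KE: "?K \<subseteq> ?E\<^sup>*"
    have "(z, z') \<in> T" if T: "monoid_congruence ?e T" "\<rho> \<subseteq> T" and "(z, z') \<in> ?K" for T z z'
      using that(3)
    proof (induction "factorization_hom S z" arbitrary: z z' rule: less_induct)
      case less
      have Teq: "equiv ?X T" using T(1) by (simp add: monoid_congruence_def)
      \<comment> \<open>Subtracting the unit vector \<open>?w\<close> of a shared atom lowers the
        value, because atoms are positive, so the induction hypothesis applies to the rest.\<close>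
      have link: "(y, y') \<in> T"
        if yy: "(y, y') \<in> linked S" and val: "factorization_hom S y = factorization_hom S z" for y y'
      proof -
        obtain i where i: "y i > 0" "y' i > 0" and yK: "(y, y') \<in> ?K"
          using yy by (auto simp: linked_def)
        let ?w = "\<lambda>j. if j = i then 1 else 0 :: nat"
        let ?u = "\<lambda>j. y j - ?w j" and ?u' = "\<lambda>j. y' j - ?w j"
        have eqs: "y = (\<lambda>j. ?u j + ?w j)" "y' = (\<lambda>j. ?u' j + ?w j)"
          using i by (auto simp: fun_eq_iff)
        have ie: "i < ?e"
        proof (rule ccontr)
          assume "\<not> i < ?e"
          then have "y i = 0" using yK by (simp add: factorization_kernel_def nat_vectors_def)
          then show False using i by simp
        qed
        have w: "?w \<in> ?X" using ie by (auto simp: nat_vectors_def)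
        have hw: "factorization_hom S ?w > 0"
          using ie nth_gen_pos[OF S ie] by (auto simp: factorization_hom_def intro!: sum_pos2[of _ i])
        have h: "factorization_hom S y = factorization_hom S ?u + factorization_hom S ?w"
          "factorization_hom S y' = factorization_hom S ?u' + factorization_hom S ?w"
          using arg_cong[OF eqs(1), of "factorization_hom S"] arg_cong[OF eqs(2), of "factorization_hom S"]
          unfolding factorization_hom_add by auto
        have "(?u, ?u') \<in> ?K"
          using yK h by (auto simp: factorization_kernel_def nat_vectors_def)
        moreover have "factorization_hom S ?u < factorization_hom S z"
          using h hw val by simp
        ultimately have "(?u, ?u') \<in> T" using less.hyps by blast
        then have "((\<lambda>j. ?u j + ?w j), (\<lambda>j. ?u' j + ?w j)) \<in> T"
          using T(1) w unfolding monoid_congruence_def by blast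
        then show ?thesis by (simp only: eqs[symmetric])
      qed
      have zX: "z \<in> ?X" using less.prems by (auto simp: factorization_kernel_def)
      have "(z, z') \<in> ?E\<^sup>*" using less.prems KE by auto
      then show ?case
      proof (induction rule: rtrancl_induct)
        case base
        then show ?case using Teq zX by (auto simp: equiv_def refl_on_def)
      next
        case (step y y')
        have "factorization_hom S y = factorization_hom S z"
          using steps_in_kernel[OF step.hyps(1) sub zX] by (auto simp: factorization_kernel_def)
        then have "(y, y') \<in> T"
          using step.hyps(2) T(2) link Teq by (auto simp: equiv_def sym_def)
        then show ?case using step.IH Teq by (meson equiv_def transD)
      qed
    qed
    then show "generated_congruence ?e \<rho> = ?K"
      using gK by (auto simp: generated_congruence_def)
  qed
  then show ?thesis using sub by (simp add: is_presentation_def)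
qed

text \<open>The vectors outside \<open>I\<close> of one value form a single component of the linking graph, and each
  element of \<open>I\<close> is a component of its own. Hence connecting the fibres is the same as growing a
  spanning tree which adds the elements of \<open>I\<close> one edge at a time.\<close>

lemma presentation_contains_tree:
  assumes S: "numerical_semigroup S"
    and fin: "finite I"
    and isolated: "\<And>v z. v \<in> I \<Longrightarrow> (v, z) \<in> linked S \<Longrightarrow> z = v"
    and rest: "\<And>z z'. (z, z') \<in> factorization_kernel S \<Longrightarrow> z \<notin> I \<Longrightarrow> z' \<notin> I \<Longrightarrow> (z, z') \<in> (linked S)\<^sup>*"
    and root: "\<And>v. v \<in> I \<Longrightarrow> \<exists>z. z \<notin> I \<and> (v, z) \<in> factorization_kernel S"
    and pres: "is_presentation S \<rho>"
  shows "\<exists>T\<subseteq>\<rho>. finite T \<and> card T = card I \<and> is_presentation S T"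
proof -
  let ?e = "embedding_dim S" and ?K = "factorization_kernel S"
  let ?E = "\<lambda>\<rho>. \<rho> \<union> \<rho>\<inverse> \<union> linked S"
  have \<rho>K: "\<rho> \<subseteq> ?K" and KE: "?K \<subseteq> (?E \<rho>)\<^sup>*" using pres is_presentation_iff[OF S] by auto
  \<comment> \<open>\<open>W\<close> is the part of \<open>I\<close> attached so far, with one edge
    of \<open>T\<close> per element. No edge of \<open>T\<close> meets \<open>I - W\<close>, so the
    next edge is new and the cardinalities keep pace.\<close>
  define P where "P W T \<longleftrightarrow> W \<subseteq> I \<and> T \<subseteq> \<rho> \<and> finite T \<and> card T = card W \<and>
     (\<forall>(a, b)\<in>T. a \<notin> I - W \<and> b \<notin> I - W) \<and>
     (\<forall>w\<in>W. \<exists>z. z \<notin> I \<and> (w, z) \<in> (?E T)\<^sup>*)" for W T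
  have step: "\<exists>v T'. v \<in> I - W \<and> P (insert v W) T'" if P: "P W T" and "W \<noteq> I" for W T
  proof -
    have "I - W \<noteq> {}" using P \<open>W \<noteq> I\<close> by (auto simp: P_def)
    then obtain v where v: "v \<in> I - W" by blast
    then obtain z where z: "z \<notin> I" "(v, z) \<in> ?K" using root by blast
    \<comment> \<open>A path leaving \<open>I - W\<close> has an edge across its boundary. Isolation
      excludes linked edges, so this edge is a relation of \<open>\<rho>\<close> in one of its two
      orientations.\<close>
    have cross: "\<exists>a b. (a, b) \<in> ?E \<rho> \<and> a \<in> I - W \<and> b \<notin> I - W"
      if "(v, z) \<in> (?E \<rho>)\<^sup>*" "v \<in> I - W" "z \<notin> I - W" for v z
      using that
    proof (induction rule: converse_rtrancl_induct)
      case base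
      then show ?case by blast
    next
      case (step v u)
      then show ?case by (cases "u \<in> I - W") blast+
    qed
    obtain a b where ab: "(a, b) \<in> ?E \<rho>" "a \<in> I - W" "b \<notin> I - W"
      using cross[of v z] v z KE by blast
    then have "(a, b) \<notin> linked S" using isolated by blast
    then obtain f where f: "f \<in> \<rho>" "f = (a, b) \<or> f = (b, a)" using ab by auto
    have fT: "f \<notin> T" using P f(2) ab by (auto simp: P_def)
    have mono: "(?E T)\<^sup>* \<subseteq> (?E (insert f T))\<^sup>*" by (rule rtrancl_mono) auto
    have "\<exists>z. z \<notin> I \<and> (b, z) \<in> (?E T)\<^sup>*"
    proof (cases "b \<in> I")
      case True
      then show ?thesis using P ab by (auto simp: P_def)
    qed auto
    then obtain y where "y \<notin> I" "(b, y) \<in> (?E (insert f T))\<^sup>*" using mono by blast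
    moreover have "(a, b) \<in> ?E (insert f T)" using f(2) by auto
    ultimately have ay: "y \<notin> I" "(a, y) \<in> (?E (insert f T))\<^sup>*" 
      by (auto intro: converse_rtrancl_into_rtrancl)
    have "finite W" using P fin by (auto simp: P_def finite_subset)
    then have "card (insert f T) = card (insert a W)" 
      using P fT ab by (auto simp: P_def)
    moreover have "\<forall>w\<in>insert a W. \<exists>z. z \<notin> I \<and> (w, z) \<in> (?E (insert f T))\<^sup>*"
    proof
      fix w assume "w \<in> insert a W"
      then show "\<exists>z. z \<notin> I \<and> (w, z) \<in> (?E (insert f T))\<^sup>*"
        using ay P mono unfolding P_def by blast
    qed
    moreover have "\<forall>(c, d)\<in>insert f T. c \<notin> I - insert a W \<and> d \<notin> I - insert a W"
      using P f(2) ab by (auto simp: P_def)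
    ultimately have "P (insert a W) (insert f T)"
      using P ab f unfolding P_def by auto
    then show ?thesis using ab by blast
  qed
  have "n \<le> card I \<Longrightarrow> \<exists>W T. P W T \<and> card W = n" for n
  proof (induction n)
    case 0
    have "P {} {}" by (simp add: P_def)
    then show ?case by (metis card.empty)
  next
    case (Suc n)
    then obtain W T where W: "P W T" "card W = n" by auto
    then have "W \<noteq> I" using Suc.prems by auto
    then obtain v T' where v: "v \<in> I - W" "P (insert v W) T'" using step W by blast
    have "finite W" using W fin by (auto simp: P_def finite_subset)
    then have "card (insert v W) = Suc n" using W v by auto
    then show ?case using v by blast
  qed
  then obtain W T where W: "P W T" "card W = card I" by blast
  then have "W = I" using fin card_subset_eq by (auto simp: P_def)
  with W have T: "T \<subseteq> \<rho>" "finite T" "card T = card I"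
    and conn: "\<And>w. w \<in> I \<Longrightarrow> \<exists>z. z \<notin> I \<and> (w, z) \<in> (?E T)\<^sup>*" by (auto simp: P_def)
  have TK: "T \<subseteq> ?K" using T \<rho>K by auto
  have toroot: "\<exists>y. y \<notin> I \<and> (z, y) \<in> (?E T)\<^sup>*" for z using conn by blast
  have symE: "sym ((?E T)\<^sup>*)"
    by (intro sym_rtrancl) (use sym_linked[of S] in \<open>auto simp: sym_def\<close>)
  have LE: "(linked S)\<^sup>* \<subseteq> (?E T)\<^sup>*" by (rule rtrancl_mono) auto
  have "(z, z') \<in> (?E T)\<^sup>*" if zz: "(z, z') \<in> ?K" for z z'
  proof -
    \<comment> \<open>Both ends are moved along \<open>T\<close> out of \<open>I\<close>, where
      \<open>rest\<close> connects them.\<close>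
    obtain y y' where y: "y \<notin> I" "(z, y) \<in> (?E T)\<^sup>*" "y' \<notin> I" "(z', y') \<in> (?E T)\<^sup>*"
      using toroot by blast
    have "(z, y) \<in> ?K" "(z', y') \<in> ?K"
      using steps_in_kernel[OF _ TK] y zz by (auto simp: factorization_kernel_def)
    then have "(y, y') \<in> ?K" using zz by (auto simp: factorization_kernel_def)
    then have "(y, y') \<in> (?E T)\<^sup>*" using rest y LE by blast
    then show ?thesis using y symE by (meson rtrancl_trans symD)
  qed
  then have "is_presentation S T" using TK is_presentation_iff[OF S] by auto
  then show ?thesis using T by blast
qed

text \<open>A minimal presentation coincides with the tree it contains, which fixes its
  cardinality.\<close>

lemma eta_eq_card:
  assumes S: "numerical_semigroup S"
    and fin: "finite I"
    and isolated: "\<And>v z. v \<in> I \<Longrightarrow> (v, z) \<in> linked S \<Longrightarrow> z = v"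
    and rest: "\<And>z z'. (z, z') \<in> factorization_kernel S \<Longrightarrow> z \<notin> I \<Longrightarrow> z' \<notin> I \<Longrightarrow> (z, z') \<in> (linked S)\<^sup>*"
    and root: "\<And>v. v \<in> I \<Longrightarrow> \<exists>z. z \<notin> I \<and> (v, z) \<in> factorization_kernel S"
  shows "eta S = card I"
proof -
  have tree: "\<exists>T\<subseteq>\<rho>. finite T \<and> card T = card I \<and> is_presentation S T"
    if "is_presentation S \<rho>" for \<rho>
    using assms that by (rule presentation_contains_tree)
  have min: "finite \<rho> \<and> card \<rho> = card I" if "minimal_presentation S \<rho>" for \<rho>
  proof -
    have "is_presentation S \<rho>" using that by (simp add: minimal_presentation_def)
    from tree[OF this] obtain T where T: "T \<subseteq> \<rho>" "finite T" "card T = card I" "is_presentation S T" by blast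
    then have "T = \<rho>" using that by (auto simp: minimal_presentation_def)
    then show ?thesis using T by auto
  qed
  \<comment> \<open>Uniqueness in \<open>eta\<close> requires that a minimal presentation exists. A
    tree inside the full kernel is one, since a smaller presentation would again contain a tree of
    the same cardinality.\<close>
  have "is_presentation S (factorization_kernel S)"
    by (auto simp: is_presentation_iff[OF S])
  from tree[OF this] obtain T where T: "finite T" "card T = card I" "is_presentation S T" by blast
  have "minimal_presentation S T"
    unfolding minimal_presentation_def
  proof (intro conjI allI impI notI)
    fix \<sigma> assume \<sigma>: "\<sigma> \<subset> T" "is_presentation S \<sigma>"
    from tree[OF \<sigma>(2)] obtain T' where "T' \<subseteq> \<sigma>" "card T' = card I" by blast
    moreover have "card T' < card T" using \<sigma>(1) \<open>T' \<subseteq> \<sigma>\<close> T(1) by (meson psubset_card_mono subset_psubset_trans)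
    ultimately show False using T by simp
  qed (use T in auto)
  then show ?thesis
    unfolding eta_def using min by (intro the_equality) auto
qed

section \<open>Factorizations as multisets\<close>

definition factorizations :: "'i set \<Rightarrow> 'i multiset set" where
  "factorizations J = {A. set_mset A \<subseteq> J}"

text \<open>Multisets over named atoms replace vectors indexed by the sorted generators;
  \<open>c\<close> is the atom of least weight and becomes the multiplicity.\<close>

locale weighted_generators =
  fixes J :: "'i set" and c :: 'i and g :: "'i \<Rightarrow> nat"
  assumes finite_J: "finite J" and c_in: "c \<in> J" and g_c_pos: "g c > 0"
    and g_c_less: "\<And>j. j \<in> J \<Longrightarrow> j \<noteq> c \<Longrightarrow> g c < g j"
begin

abbreviation F :: "'i multiset set" where "F \<equiv> factorizations J"

definition val :: "'i multiset \<Rightarrow> nat" where "val A = (\<Sum>x\<in>#A. g x)"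

definition semigroup :: "nat set" where "semigroup = val ` F"

text \<open>For \<open>b\<close> in the semigroup this says that \<open>b\<close> lies outside the
  Apery set of \<open>g c\<close>.\<close>

definition reducible :: "nat \<Rightarrow> bool" where
  "reducible b \<longleftrightarrow> (\<exists>B\<in>F. b = g c + val B)"

definition link :: "('i multiset \<times> 'i multiset) set" where
  "link = {(A, B). A \<in> F \<and> B \<in> F \<and> val A = val B \<and> (\<exists>x. x \<in># A \<and> x \<in># B)}"

text \<open>All factorizations of one element that contain \<open>c\<close> are linked through it,
  so each fibre has at most one tied component.\<close>

definition tied :: "'i multiset \<Rightarrow> bool" where
  "tied A \<longleftrightarrow> (\<exists>B. (A, B) \<in> link\<^sup>* \<and> c \<in># B)"

lemma val_simps [simp]:
  "val {#} = 0" "val (add_mset x A) = g x + val A" "val (A + B) = val A + val B"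
  "val (replicate_mset n x) = n * g x"
  by (auto simp: val_def)

lemma F_simps [simp]:
  "{#} \<in> F" "add_mset x A \<in> F \<longleftrightarrow> x \<in> J \<and> A \<in> F" "A + B \<in> F \<longleftrightarrow> A \<in> F \<and> B \<in> F"
  "replicate_mset n x \<in> F \<longleftrightarrow> n = 0 \<or> x \<in> J"
  by (auto simp: factorizations_def)

lemma g_pos: "j \<in> J \<Longrightarrow> g j > 0"
  using g_c_pos g_c_less by (metis gr_implies_not0 not_gr_zero)

lemma reducibleI: "B \<in> F \<Longrightarrow> b = g c + val B \<Longrightarrow> reducible b"
  by (auto simp: reducible_def)

lemma link_steps_F: "(A, B) \<in> link\<^sup>* \<Longrightarrow> A \<in> F \<Longrightarrow> B \<in> F \<and> val B = val A"
  by (induction rule: rtrancl_induct) (auto simp: link_def)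

lemma sym_link_steps: "sym (link\<^sup>*)"
  by (intro sym_rtrancl) (auto simp: sym_def link_def)

lemma tied_if_mem: "c \<in># A \<Longrightarrow> tied A"
  by (auto simp: tied_def)

lemma tied_step: "(A, B) \<in> link \<Longrightarrow> tied B \<Longrightarrow> tied A"
  by (auto simp: tied_def intro: converse_rtrancl_into_rtrancl)

lemma link_exchange:
  assumes "V \<in> F" "V' \<in> F" "val V = val V'" "W \<in> F" "W \<noteq> {#}"
  shows "(V + W, V' + W) \<in> link"
proof -
  obtain x where "x \<in># W" using assms(5) by auto
  then show ?thesis using assms by (auto simp: link_def)
qed

text \<open>\<open>V\<close> can be traded for a factorization containing \<open>c\<close> while an
  atom of \<open>W\<close> stays shared.\<close>

lemma tied_add:
  assumes "reducible (val V)" "V \<in> F" "W \<in> F" "W \<noteq> {#}"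
  shows "tied (V + W)"
proof -
  obtain B where "B \<in> F" "val V = val (add_mset c B)"
    using assms(1) by (auto simp: reducible_def)
  then show ?thesis
    using link_exchange[OF assms(2) _ _ assms(3,4), of "add_mset c B"] c_in
    by (intro tied_step[OF _ tied_if_mem]) auto
qed

lemma tied_superset:
  assumes "reducible (val V)" "V \<subseteq># A" "A \<in> F"
  shows "A = V \<or> tied A"
proof -
  obtain W where "A = V + W" using assms(2) by (metis subset_mset.le_iff_add)
  then show ?thesis using tied_add[of V W] assms by (cases "W = {#}") auto
qed

lemma reducible_add: "reducible b \<Longrightarrow> A \<in> F \<Longrightarrow> reducible (val A + b)"
  unfolding reducible_def by (metis F_simps(3) add.left_commute val_simps(3))

lemma tied_reducible:
  assumes "A \<in> F" "tied A"
  shows "reducible (val A)"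
proof -
  obtain B where B: "(A, B) \<in> link\<^sup>*" "c \<in># B" using assms by (auto simp: tied_def)
  then obtain B' where B': "B = add_mset c B'" by (meson multi_member_split)
  show ?thesis using link_steps_F[OF B(1) assms(1)] unfolding B' by (auto simp: reducible_def intro!: bexI[of _ B'])
qed

lemma tied_tied:
  assumes "A \<in> F" "A' \<in> F" "tied A" "tied A'" "val A = val A'"
  shows "(A, A') \<in> link\<^sup>*"
proof -
  obtain B B' where B: "(A, B) \<in> link\<^sup>*" "c \<in># B" "(A', B') \<in> link\<^sup>*" "c \<in># B'"
    using assms by (auto simp: tied_def)
  then have "(B, B') \<in> link"
    using link_steps_F[OF B(1) assms(1)] link_steps_F[OF B(3) assms(2)] assms(5)
    by (auto simp: link_def)
  moreover have "(B', A') \<in> link\<^sup>*" using B sym_link_steps by (meson symD)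
  ultimately show ?thesis using B by (meson rtrancl.rtrancl_into_rtrancl rtrancl_trans)
qed

lemma val_eq_sum:
  assumes "A \<in> F"
  shows "val A = (\<Sum>j\<in>J. count A j * g j)"
  using assms
proof (induction A)
  case (add x A)
  have "(\<Sum>j\<in>J. count (add_mset x A) j * g j) = (\<Sum>j\<in>J. (if j = x then g j else 0) + count A j * g j)"
    by (intro sum.cong) auto
  also have "\<dots> = g x + (\<Sum>j\<in>J. count A j * g j)"
    using add.prems finite_J by (simp add: sum.distrib)
  finally show ?case using add by simp
qed simp

text \<open>For \<open>q > 0\<close>, dividing \<open>n \<ge> q * q\<close> by \<open>q\<close>
  gives \<open>n = a q + r\<close> with \<open>r < q \<le> a\<close>, hence
  \<open>n = (a - r) q + r (q + 1)\<close>.\<close>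

lemma finite_complement_of_consecutive:
  assumes "q \<in> semigroup" "Suc q \<in> semigroup"
  shows "finite (- semigroup)"
proof -
  have mult: "n * b \<in> semigroup" if b: "b \<in> semigroup" for n b
  proof -
    obtain B where B: "B \<in> F" "val B = b" using b by (auto simp: semigroup_def)
    have "repeat_mset n B \<in> F" using B(1) by (induction n) (auto simp: factorizations_def)
    moreover have "val (repeat_mset n B) = n * b"
      using B(2) by (induction n) (auto simp: val_def)
    ultimately show ?thesis by (force simp: semigroup_def)
  qed
  have add: "b + b' \<in> semigroup" if "b \<in> semigroup" "b' \<in> semigroup" for b b'
  proof -
    obtain B B' where "B \<in> F" "b = val B" "B' \<in> F" "b' = val B'"
      using \<open>b \<in> semigroup\<close> \<open>b' \<in> semigroup\<close> by (auto simp: semigroup_def)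
    then show ?thesis by (auto simp: semigroup_def intro!: image_eqI[of _ _ "B + B'"])
  qed
  have "n \<in> semigroup" if n: "n \<ge> q * q" for n
  proof (cases "q = 0")
    case True
    then show ?thesis using mult[of "Suc q" n] assms by simp
  next
    case False
    let ?a = "n div q" and ?r = "n mod q"
    have "?a \<ge> q" using n False by (simp add: less_eq_div_iff_mult_less_eq)
    then have le: "?r \<le> ?a" using False mod_less_divisor[of q n] by linarith
    have "n = ?a * q + ?r" by simp
    also have "\<dots> = (?a - ?r) * q + ?r * Suc q"
      using le by (simp add: diff_mult_distrib algebra_simps)
    also have "\<dots> \<in> semigroup" using add mult assms by blast
    finally show ?thesis .
  qed
  then have "- semigroup \<subseteq> {..<q * q}" using not_le_imp_less by blast
  then show ?thesis by (rule finite_subset) simp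
qed

end

text \<open>\<open>N\<close> holds one factorization of each element of the Apery set with respect to \<open>g c\<close>, and \<open>E\<close>
  those members of \<open>N\<close> whose value has other factorizations. \<open>I\<close> contains one side of each minimal
  relation.\<close>

locale apery_presentation = weighted_generators J c g
  for J :: "'i set" and c :: 'i and g :: "'i \<Rightarrow> nat" +
  fixes N E I :: "'i multiset set"
  assumes cofinite: "finite (- semigroup)"
    and N_sub: "N \<subseteq> F"
    and N_residue: "\<And>A B. A \<in> N \<Longrightarrow> B \<in> N \<Longrightarrow> val A mod g c = val B mod g c \<Longrightarrow> A = B"
    and trichotomy: "\<And>A. A \<in> F \<Longrightarrow> A \<in> I \<or> A \<in> N \<or> tied A"
    and finite_I: "finite I" and I_sub: "I \<subseteq> F"
    and I_N: "I \<inter> N = {}" and c_notin: "\<And>A. A \<in> I \<Longrightarrow> c \<notin># A"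
    and I_val: "\<And>A. A \<in> I \<Longrightarrow> reducible (val A) \<or> (\<exists>B\<in>E. val B = val A)"
    and E_N: "E \<subseteq> N"
    and I_minimal: "\<And>A x. A \<in> I \<Longrightarrow> x \<in># A \<Longrightarrow> A - {#x#} \<in> N - E"
    and gens_N: "\<And>j. j \<in> J \<Longrightarrow> j \<noteq> c \<Longrightarrow> {#j#} \<in> N - E"
begin

text \<open>Copies of \<open>g c\<close> are split off until the value is irreducible. Then the
  factorization is not tied, and if it is in \<open>I\<close> it shares its value with a member of
  \<open>E\<close>, so trichotomy ends in \<open>N\<close>.\<close>

lemma reduce:
  assumes "A \<in> F"
  shows "\<exists>B\<in>N. \<exists>q. val A = val B + q * g c \<and> (reducible (val A) \<longrightarrow> q > 0)"
  using assms
proof (induction "val A" arbitrary: A rule: less_induct)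
  case less
  show ?case
  proof (cases "reducible (val A)")
    case True
    then obtain A' where A': "A' \<in> F" "val A = g c + val A'" by (auto simp: reducible_def)
    then obtain B q where "B \<in> N" "val A' = val B + q * g c"
      using less.hyps[of A'] g_c_pos by auto
    then have "B \<in> N" "val A = val B + Suc q * g c" using A' by auto
    then show ?thesis by blast
  next
    case False
    then have "\<exists>B\<in>N. val B = val A"
      using trichotomy[OF less.prems] tied_reducible[OF less.prems] I_val E_N by blast
    then show ?thesis using False by (metis add.right_neutral mult_zero_left)
  qed
qed

text \<open>Splitting off a copy of \<open>g c\<close> would lead to a member of \<open>N\<close> of
  smaller value in the same residue class, where \<open>A\<close> is the only one.\<close>

lemma N_irreducible:
  assumes A: "A \<in> N"
  shows "\<not> reducible (val A)"
proof
  assume "reducible (val A)"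
  then obtain B q where B: "B \<in> N" "val A = val B + q * g c" "q > 0"
    using reduce[of A] A N_sub by blast
  then have "A = B" using N_residue[OF A B(1)] by simp
  then show False using B g_c_pos by simp
qed

text \<open>A tied \<open>B\<close> would make the value reducible, and a \<open>B\<close> in
  \<open>I\<close> would make it the value of a member of \<open>E\<close>, which could only be
  \<open>A\<close>. So \<open>B\<close> lies in \<open>N\<close>, where residues determine
  members.\<close>

lemma unique_factorization:
  assumes A: "A \<in> N - E" and "B \<in> F" "val B = val A"
  shows "B = A"
proof -
  have "\<not> tied B" using N_irreducible[of A] tied_reducible[of B] assms by auto
  moreover have "B \<notin> I"
  proof
    assume "B \<in> I"
    then obtain B' where "B' \<in> E" "val B' = val A"
      using I_val[of B] N_irreducible[of A] assms by auto
    then show False using N_residue[of B' A] E_N assms by auto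
  qed
  ultimately have "B \<in> N" using trichotomy assms by blast
  then show ?thesis using N_residue assms by auto
qed

lemma numerical_semigroup: "numerical_semigroup semigroup"
  unfolding numerical_semigroup_def
proof (intro conjI ballI cofinite)
  show "0 \<in> semigroup" by (auto simp: semigroup_def intro!: image_eqI[of _ _ "{#}"])
next
  fix a b assume "a \<in> semigroup" "b \<in> semigroup"
  then obtain A B where "A \<in> F" "a = val A" "B \<in> F" "b = val B" by (auto simp: semigroup_def)
  then show "a + b \<in> semigroup" by (auto simp: semigroup_def intro!: image_eqI[of _ _ "A + B"])
qed

lemma g_c_le:
  assumes "A \<in> F" "A \<noteq> {#}"
  shows "g c \<le> val A"
proof -
  obtain x A' where A: "A = add_mset x A'" using assms(2) by (meson multiset_cases)
  then have "g c \<le> g x" using assms(1) g_c_less[of x] by fastforce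
  then show ?thesis using A by simp
qed

lemma irreducibles_eq: "irreducibles semigroup = g ` J"
proof
  show "irreducibles semigroup \<subseteq> g ` J"
  proof
    fix b assume b: "b \<in> irreducibles semigroup"
    then obtain A where A: "A \<in> F" "b = val A" "b \<noteq> 0" by (auto simp: irreducibles_def semigroup_def)
    then obtain x A' where A': "A = add_mset x A'" by (metis multiset_cases val_simps(1))
    have x: "x \<in> J" "A' \<in> F" using A A' by auto
    then have "g x \<in> semigroup" "val A' \<in> semigroup"
      by (auto simp: semigroup_def intro!: image_eqI[of _ _ "{#x#}"])
    then have "val A' = 0"
      using b A A' g_pos[OF x(1)] unfolding irreducibles_def by fastforce
    then show "b \<in> g ` J" using A A' x by simp
  qed
next
  show "g ` J \<subseteq> irreducibles semigroup"
  proof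
    fix b assume "b \<in> g ` J"
    then obtain j where j: "j \<in> J" "b = g j" by auto
    have "a = 0 \<or> a' = 0" if "a \<in> semigroup" "a' \<in> semigroup" "b = a + a'" for a a'
    proof -
      obtain A A' where A: "A \<in> F" "a = val A" "A' \<in> F" "a' = val A'"
        using \<open>a \<in> semigroup\<close> \<open>a' \<in> semigroup\<close> by (auto simp: semigroup_def)
      show ?thesis
      proof (cases "j = c")
        case True
        \<comment> \<open>Two nonzero summands would each be at least \<open>g c\<close>.\<close>
        then show ?thesis
          using g_c_le[of A] g_c_le[of A'] A g_c_pos that(3) j(2) by fastforce
      next
        case False
        then have "A + A' = {#j#}"
          using unique_factorization[OF gens_N[OF j(1)], of "A + A'"] A that j by simp
        then show ?thesis using A by (auto simp: union_is_single)
      qed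
    qed
    moreover have "b \<in> semigroup"
      using j by (auto simp: semigroup_def intro!: image_eqI[of _ _ "{#j#}"])
    ultimately show "b \<in> irreducibles semigroup"
      using j g_pos unfolding irreducibles_def by blast
  qed
qed

lemma min_gens: "min_gens semigroup = g ` J"
  by (simp add: min_gens_eq_irreducibles[OF numerical_semigroup] irreducibles_eq)

lemma inj_on_g: "inj_on g J"
proof (rule inj_onI)
  fix i j assume ij: "i \<in> J" "j \<in> J" "g i = g j"
  show "i = j"
  proof (cases "j = c")
    case True
    then show ?thesis using ij g_c_less by (metis less_irrefl)
  next
    case False
    then have "{#i#} = {#j#}" using unique_factorization[OF gens_N[OF ij(2)], of "{#i#}"] ij by simp
    then show ?thesis by simp
  qed
qed

lemma embedding_dim: "embedding_dim semigroup = card J"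
  by (simp add: embedding_dim_def min_gens card_image inj_on_g)

lemma multiplicity: "semigroup_multiplicity semigroup = g c"
  unfolding semigroup_multiplicity_def min_gens
  using finite_J c_in g_c_less by (intro Min_eqI) (auto, metis less_imp_le order_refl)

text \<open>\<open>h\<close> numbers \<open>J\<close> by increasing weight and \<open>\<Phi>\<close>
  turns multisets into vectors over this numbering, preserving values and links;
  \<open>eta_eq_card\<close> then applies to the image of \<open>I\<close>.\<close>

lemma eta: "eta semigroup = card I"
proof -
  let ?S = semigroup and ?e = "card J"
  let ?X = "nat_vectors ?e"
  have "bij_betw (nth_gen ?S) {..<?e} (g ` J)"
    unfolding nth_gen_def min_gens
    by (rule bij_betw_nth) (auto simp: finite_J card_image inj_on_g)
  moreover have "bij_betw (inv_into J g) (g ` J) J"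
    by (intro bij_betw_inv_into inj_on_imp_bij_betw inj_on_g)
  ultimately have bij: "bij_betw (inv_into J g \<circ> nth_gen ?S) {..<?e} J"
    by (rule bij_betw_trans)
  define h where "h = inv_into J g \<circ> nth_gen ?S"
  have bij_h: "bij_betw h {..<?e} J" using bij by (simp add: h_def)
  have gh: "g (h i) = nth_gen ?S i" if "i < ?e" for i
    using that bij_betwE[OF \<open>bij_betw (nth_gen ?S) {..<?e} (g ` J)\<close>]
    by (simp add: h_def f_inv_into_f)
  define \<Phi> where "\<Phi> A = (\<lambda>i. if i < ?e then count A (h i) else 0)" for A
  have \<Phi>_X: "\<Phi> A \<in> ?X" for A by (simp add: \<Phi>_def nat_vectors_def)
  have hom: "factorization_hom ?S (\<Phi> A) = val A" if "A \<in> F" for A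
  proof -
    have "factorization_hom ?S (\<Phi> A) = (\<Sum>i<?e. count A (h i) * g (h i))"
      unfolding factorization_hom_def embedding_dim by (intro sum.cong) (auto simp: \<Phi>_def gh)
    also have "\<dots> = (\<Sum>j\<in>J. count A j * g j)" by (rule sum.reindex_bij_betw[OF bij_h])
    finally show ?thesis using val_eq_sum[OF that] by simp
  qed
  have surj: "\<exists>A\<in>F. \<Phi> A = z" if "z \<in> ?X" for z
  proof -
    let ?A = "\<Sum>i<?e. replicate_mset (z i) (h i)"
    have "count ?A (h i) = z i" if "i < ?e" for i
    proof -
      have "count ?A (h i) = (\<Sum>j<?e. if j = i then z j else 0)"
        unfolding count_sum using that bij_h
        by (intro sum.cong) (auto simp: bij_betw_def inj_on_eq_iff)
      then show ?thesis using that by simp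
    qed
    then have "\<Phi> ?A = z" using that by (auto simp: \<Phi>_def nat_vectors_def fun_eq_iff)
    moreover have "?A \<in> F"
      using bij_h by (auto simp: factorizations_def set_mset_sum bij_betw_def split: if_splits)
    ultimately show ?thesis by blast
  qed
  have inj: "A = B" if "A \<in> F" "B \<in> F" "\<Phi> A = \<Phi> B" for A B
  proof (rule multiset_eqI)
    fix x
    show "count A x = count B x"
    proof (cases "x \<in> J")
      case True
      then obtain i where i: "i < ?e" "x = h i" using bij_h by (auto simp: bij_betw_def)
      then show ?thesis using fun_cong[OF that(3), of i] by (simp add: \<Phi>_def)
    next
      case False
      then have "x \<notin># A" "x \<notin># B" using that by (auto simp: factorizations_def)
      then show ?thesis by (simp add: not_in_iff)
    qed
  qed
  have ker: "(\<Phi> A, \<Phi> B) \<in> factorization_kernel ?S \<longleftrightarrow> val A = val B" if "A \<in> F" "B \<in> F" for A B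
    using that \<Phi>_X by (auto simp: factorization_kernel_def embedding_dim hom)
  have link: "(\<Phi> A, \<Phi> B) \<in> linked ?S \<longleftrightarrow> (A, B) \<in> link" if AB: "A \<in> F" "B \<in> F" for A B
  proof -
    have "(\<exists>i. \<Phi> A i > 0 \<and> \<Phi> B i > 0) \<longleftrightarrow> (\<exists>i<?e. h i \<in># A \<and> h i \<in># B)"
      by (auto simp: \<Phi>_def)
    also have "\<dots> \<longleftrightarrow> (\<exists>x\<in>J. x \<in># A \<and> x \<in># B)"
      using bij_h unfolding bij_betw_def by (metis (no_types, lifting) imageE image_eqI lessThan_iff)
    also have "\<dots> \<longleftrightarrow> (\<exists>x. x \<in># A \<and> x \<in># B)" using AB by (auto simp: factorizations_def)
    finally show ?thesis using ker[OF AB] AB by (auto simp: linked_def link_def)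
  qed
  have steps: "(\<Phi> A, \<Phi> B) \<in> (linked ?S)\<^sup>*" if "(A, B) \<in> link\<^sup>*" "A \<in> F" for A B
    using that
  proof (induction rule: rtrancl_induct)
    case (step B C)
    then have "(B, C) \<in> link" "B \<in> F" "C \<in> F" by (auto simp: link_def)
    then show ?case using step link by (meson rtrancl.rtrancl_into_rtrancl)
  qed simp
  have "eta ?S = card (\<Phi> ` I)"
  proof (rule eta_eq_card[OF numerical_semigroup])
    show "finite (\<Phi> ` I)" using finite_I by simp
  next
    fix v z assume "v \<in> \<Phi> ` I" and vz: "(v, z) \<in> linked ?S"
    then obtain A where A: "A \<in> I" "v = \<Phi> A" "A \<in> F" using I_sub by auto
    have "z \<in> ?X" using vz by (auto simp: linked_def factorization_kernel_def embedding_dim)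
    then obtain B where B: "B \<in> F" "z = \<Phi> B" using surj by blast
    then have AB: "(A, B) \<in> link" using link vz A by blast
    then obtain x where x: "x \<in># A" "x \<in># B" by (auto simp: link_def)
    then obtain A' B' where A': "A = add_mset x A'" and B': "B = add_mset x B'"
      by (meson multi_member_split)
    \<comment> \<open>After removal of the shared atom the rest of \<open>A\<close> has a unique
      factorization, so the rest of \<open>B\<close> equals it.\<close>
    have "A' \<in> N - E" using I_minimal[OF A(1) x(1)] A' by simp
    moreover have "val B' = val A'" "B' \<in> F" using AB A' B' by (auto simp: link_def)
    ultimately have "B' = A'" using unique_factorization by blast
    then show "z = v" using A B A' B' by simp
  next
    fix z z' assume zz: "(z, z') \<in> factorization_kernel ?S" "z \<notin> \<Phi> ` I" "z' \<notin> \<Phi> ` I"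
    then have "z \<in> ?X" "z' \<in> ?X" by (auto simp: factorization_kernel_def embedding_dim)
    then obtain A B where A: "A \<in> F" "z = \<Phi> A" and B: "B \<in> F" "z' = \<Phi> B" using surj by metis
    then have val: "val A = val B" and I: "A \<notin> I" "B \<notin> I" using zz ker by auto
    \<comment> \<open>The mixed cases are impossible, since members of \<open>N\<close> have
      irreducible values and tied factorizations reducible ones.\<close>
    consider "A \<in> N" "B \<in> N" | "tied A" "tied B"
      using trichotomy[OF A(1)] trichotomy[OF B(1)] I val N_irreducible
        tied_reducible[OF A(1)] tied_reducible[OF B(1)] by metis
    then have "(A, B) \<in> link\<^sup>*"
    proof cases
      case 1
      then have "A = B" using N_residue val by metis
      then show ?thesis by simp
    next
      case 2
      then show ?thesis using tied_tied A B val by blast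
    qed
    then show "(z, z') \<in> (linked ?S)\<^sup>*" using steps A B by blast
  next
    fix v assume "v \<in> \<Phi> ` I"
    then obtain A where A: "A \<in> I" "v = \<Phi> A" "A \<in> F" using I_sub by auto
    \<comment> \<open>A factorization containing \<open>c\<close> serves if the value is reducible,
      otherwise a member of \<open>E\<close> does.\<close>
    have "\<exists>B\<in>F. B \<notin> I \<and> val B = val A"
    proof (cases "reducible (val A)")
      case True
      then obtain B where "B \<in> F" "val A = g c + val B" by (auto simp: reducible_def)
      then show ?thesis using c_notin[of "add_mset c B"] c_in
        by (intro bexI[of _ "add_mset c B"]) auto
    next
      case False
      then show ?thesis using I_val[OF A(1)] I_N N_sub E_N by blast
    qed
    then obtain B where B: "B \<in> F" "B \<notin> I" "val A = val B" by auto
    have "\<Phi> B \<notin> \<Phi> ` I" using B inj I_sub by blast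
    then show "\<exists>z. z \<notin> \<Phi> ` I \<and> (v, z) \<in> factorization_kernel ?S"
      using ker[of A B] A B by blast
  qed
  also have "\<dots> = card I" using inj I_sub by (intro card_image inj_onI) blast
  finally show ?thesis .
qed

end

section \<open>The family of semigroups\<close>

lemma add_mset_eq_replicate_mset_iff:
  "add_mset x A = replicate_mset n y \<longleftrightarrow> x = y \<and> n > 0 \<and> A = replicate_mset (n - 1) y"
proof (cases n)
  case (Suc k)
  have "x = y" if "add_mset x A = add_mset y (replicate_mset k y)"
    using that by (metis in_replicate_mset replicate_mset_Suc union_single_eq_member)
  then show ?thesis using Suc by auto
qed simp

lemma replicate_mset_eq_replicate_mset_iff:
  "replicate_mset n x = replicate_mset n' x \<longleftrightarrow> n = n'"
  by (metis size_replicate_mset)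

lemma replicate_mset_eq_add_mset_iff:
  "replicate_mset n y = add_mset x A \<longleftrightarrow> x = y \<and> n > 0 \<and> A = replicate_mset (n - 1) y"
  by (subst eq_commute) (rule add_mset_eq_replicate_mset_iff)

lemmas replicate_mset_eq_simps = add_mset_eq_replicate_mset_iff
  replicate_mset_eq_add_mset_iff replicate_mset_eq_replicate_mset_iff

datatype gen = M | Z | X | Y nat

text \<open>Modulo \<open>m\<close> the weights of \<open>Z\<close>, \<open>X\<close> and \<open>Y i\<close> are \<open>-1\<close>, \<open>p + 2\<close> and \<open>i\<close>. The numbers \<open>d\<close> and \<open>z\<close> are
  chosen to satisfy \<open>z + d = 2m\<^sup>2\<close> and \<open>K d = a z + m\<close>, so that a sum of atoms outside the Apery set
  exceeds the element of its residue class by an explicit multiple of \<open>m\<close>: multiples \<open>t d\<close> with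
  \<open>t < K\<close> are compared directly, those with \<open>t \<ge> K\<close> after trading \<open>K d\<close> for \<open>a z + m\<close>.\<close>

locale gen_family =
  fixes p K a :: nat and cross :: bool
  assumes p_pos: "1 \<le> p" and p_less: "p < K" and a_pos: "1 \<le> a"
begin

text \<open>In both families below, the multiples \<open>z, ..., a z\<close> fill the
  \<open>a\<close> residue classes \<open>K, ..., m - 1\<close>, and the other Apery elements fill
  the classes below \<open>K\<close>.\<close>

definition m :: nat where "m = K + a"
definition d :: nat where "d = 2 * m * a + 1"
definition z :: nat where "z = 2 * m * K - 1"

primrec w :: "gen \<Rightarrow> nat" where
  "w M = m"
| "w Z = z"
| "w X = (p + 2) * d"
| "w (Y i) = m * m + i * d"

definition J :: "gen set" where
  "J = {M, Z} \<union> Y ` {1..p} \<union> (if cross then {X} else {})"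

lemma m_ge: "3 \<le> m"
  using p_pos p_less a_pos by (simp add: m_def)

lemma Suc_z: "Suc z = 2 * m * K"
  using m_ge p_less by (simp add: z_def)

lemma z_add_d: "z + d = 2 * (m * m)"
proof -
  have "z + d = Suc z + 2 * m * a" by (simp add: d_def)
  also have "\<dots> = 2 * (m * (K + a))" unfolding Suc_z by (simp add: algebra_simps)
  finally show ?thesis by (simp add: m_def)
qed

lemma K_d: "K * d = a * z + m"
proof -
  have "K * d = a * Suc z + K" unfolding Suc_z by (simp add: d_def algebra_simps)
  then show ?thesis by (simp add: m_def)
qed

lemma J_simps [simp]: "M \<in> J" "Z \<in> J" "Y i \<in> J \<longleftrightarrow> 1 \<le> i \<and> i \<le> p" "X \<in> J \<longleftrightarrow> cross"
  by (auto simp: J_def)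

sublocale weighted_generators J M w
proof
  show "finite J" by (simp add: J_def)
  show "M \<in> J" by simp
  show "w M > 0" using m_ge by simp
  have "1 \<le> K" using p_pos p_less by simp
  then have "m * 1 \<le> m * K" by (intro mult_le_mono) auto
  then have "m < z" using m_ge Suc_z by linarith
  moreover have "m < (p + 2) * d"
  proof -
    have "m * 1 \<le> m * a" using a_pos by (intro mult_le_mono) auto
    then have "m < d" unfolding d_def mult.assoc by linarith
    also have "d \<le> (p + 2) * d" by simp
    finally show ?thesis .
  qed
  moreover have "m < m * m + i * d" for i
  proof -
    have "2 * m \<le> m * m" using m_ge by (intro mult_le_mono) auto
    then show ?thesis using m_ge by linarith
  qed
  ultimately show "w M < w j" if "j \<in> J" "j \<noteq> M" for j
    using that by (cases j) auto
qed

lemma card_J: "card J = p + 2 + (if cross then 1 else 0)"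
proof -
  have "card (Y ` {1..p}) = p" by (simp add: card_image inj_on_def)
  moreover have "J = insert M (insert Z (Y ` {1..p} \<union> (if cross then {X} else {})))" 
    by (auto simp: J_def)
  ultimately show ?thesis by (auto simp: card_insert_if image_iff)
qed

lemma cofinite_semigroup: "finite (- semigroup)"
proof (rule finite_complement_of_consecutive)
  show "z \<in> semigroup" by (auto simp: semigroup_def intro!: image_eqI[of _ _ "{#Z#}"])
  show "Suc z \<in> semigroup"
    unfolding Suc_z semigroup_def by (rule image_eqI[of _ _ "replicate_mset (2 * K) M"]) auto
qed

text \<open>Trading \<open>K d\<close> for \<open>a z + m\<close> yields the required
  \<open>m\<close>. Copies of \<open>z\<close> and \<open>d\<close> then merge in pairs into
  \<open>2 m^2\<close>: if \<open>u \<le> a\<close>, there remain \<open>a - u\<close> copies of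
  \<open>z\<close>, otherwise \<open>u - a\<close> copies of \<open>d\<close>, which form
  \<open>Y (u - a)\<close> with one \<open>m^2\<close>.\<close>

lemma reducible_wrap:
  assumes "u \<le> p + 1"
  shows "reducible ((K + u) * d + n * (m * m))"
proof (cases "u \<le> a")
  case True
  have "(K + u) * d + n * (m * m) = a * z + m + u * d + n * (m * m)"
    by (simp add: algebra_simps K_d)
  also have "a * z = (a - u) * z + u * z" using True by (simp add: diff_mult_distrib)
  also have "(a - u) * z + u * z + m + u * d + n * (m * m)
      = m + ((a - u) * z + u * (z + d) + n * (m * m))" by (simp add: algebra_simps)
  also have "\<dots> = w M + val (replicate_mset (a - u) Z + replicate_mset ((2 * u + n) * m) M)"
    unfolding z_add_d by (simp add: algebra_simps)
  finally show ?thesis by (rule reducibleI[rotated]) auto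
next
  case False
  have "(K + u) * d + n * (m * m) = a * z + m + u * d + n * (m * m)"
    by (simp add: algebra_simps K_d)
  also have "u * d = (u - a) * d + a * d" using False by (simp add: diff_mult_distrib)
  also have "a * z + m + ((u - a) * d + a * d) + n * (m * m)
      = m + ((u - a) * d + a * (z + d) + n * (m * m))" by (simp add: algebra_simps)
  \<comment> \<open>One \<open>m^2\<close> is set aside for \<open>Y (u - a)\<close>, whose index is
    at most \<open>p\<close> because \<open>a \<ge> 1\<close>.\<close>
  also have "a * (z + d) = m * m + (2 * a - 1) * (m * m)"
  proof -
    have "a * (z + d) = (1 + (2 * a - 1)) * (m * m)" unfolding z_add_d using a_pos by simp
    then show ?thesis by (simp only: distrib_right mult_1)
  qed
  also have "m + ((u - a) * d + (m * m + (2 * a - 1) * (m * m)) + n * (m * m))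
      = w M + val (add_mset (Y (u - a)) (replicate_mset ((2 * a - 1 + n) * m) M))"
    (is "_ = _ + val ?B") by (simp add: algebra_simps)
  finally have "(K + u) * d + n * (m * m) = w M + val ?B" .
  moreover have "?B \<in> F" using False assms a_pos by auto
  ultimately show ?thesis by (rule reducibleI[rotated])
qed

text \<open>One \<open>m^2\<close> goes into \<open>Y t\<close>, and any further one is a multiple
  of \<open>m\<close>. For \<open>t = 0\<close>, where there is no \<open>Y t\<close>, the whole
  value is such a multiple.\<close>

lemma reducible_low:
  assumes "t \<le> p" "2 \<le> n"
  shows "reducible (t * d + n * (m * m))"
proof (cases "t = 0")
  case True
  have "n * m \<ge> 1" using assms m_ge by simp
  then have "n * (m * m) = m + (n * m - 1) * m" by (simp add: diff_mult_distrib)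
  then show ?thesis
    using True by (intro reducibleI[of "replicate_mset (n * m - 1) M"]) auto
next
  case False
  obtain n' where n': "n = n' + 2" using assms(2) by (metis le_add_diff_inverse2)
  obtain q where q: "m = Suc q" using m_ge by (metis gr0_conv_Suc less_le_trans zero_less_numeral)
  have "n * (m * m) = m * m + m + (n' * m + q) * m" unfolding n' using q by (simp add: algebra_simps)
  then show ?thesis
    using False assms
    by (intro reducibleI[of "add_mset (Y t) (replicate_mset (n' * m + q) M)"]) auto
qed

lemma val_YY: "val {#Y i, Y j#} = (i + j) * d + 2 * (m * m)"
  by (simp add: algebra_simps)

text \<open>\<open>Z\<close> merges with one \<open>d\<close> into \<open>2 m^2\<close>, leaving
  \<open>i - 1\<close> copies of \<open>d\<close> and three of \<open>m^2\<close>.\<close>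

lemma reducible_YZ:
  assumes "1 \<le> i" "i \<le> p"
  shows "reducible (val {#Y i, Z#})"
proof -
  have "i * d = (i - 1) * d + d" using assms by (simp add: diff_mult_distrib)
  then have "val {#Y i, Z#} = (i - 1) * d + (z + d) + m * m" by simp
  also have "\<dots> = (i - 1) * d + 3 * (m * m)" unfolding z_add_d by simp
  finally show ?thesis using reducible_low[of "i - 1" 3] assms by (simp only:)
qed

text \<open>\<open>a z + m\<close> becomes \<open>K d\<close>, and the last \<open>z\<close> merges
  with one \<open>d\<close>. The \<open>m\<close> is added on the left to avoid a
  subtraction.\<close>

lemma val_chain: "val (replicate_mset (Suc a) Z) + m = (K - 1) * d + 2 * (m * m)"
proof -
  have "val (replicate_mset (Suc a) Z) + m = z + K * d" by (simp add: K_d)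
  also have "K * d = (K - 1) * d + d" using p_less by (simp add: diff_mult_distrib)
  finally show ?thesis using z_add_d by simp
qed

lemma val_mod:
  "val {#Y i#} mod m = i mod m"
  "val {#X#} mod m = (p + 2) mod m"
  "val {#X, Z#} mod m = (p + 1) mod m"
  "val {#X, Y i#} mod m = (p + 2 + i) mod m"
proof -
  have d: "d = 2 * a * m + 1" by (simp add: d_def)
  have t: "(t * d + n * m) mod m = t mod m" for t n
  proof -
    have "t * d + n * m = t + (t * 2 * a + n) * m" unfolding d by (simp add: algebra_simps)
    then show ?thesis by simp
  qed
  show "val {#Y i#} mod m = i mod m" using t[of i m] by (simp add: add.commute)
  show "val {#X#} mod m = (p + 2) mod m" using t[of "p + 2" 0] by simp
  have "val {#X, Z#} = (p + 1) * d + (z + d)" by simp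
  also have "\<dots> = (p + 1) * d + (2 * m) * m" unfolding z_add_d by simp
  finally show "val {#X, Z#} mod m = (p + 1) mod m" using t[of "p + 1" "2 * m"] by (simp only:)
  have "val {#X, Y i#} = (p + 2 + i) * d + m * m" by (simp add: algebra_simps)
  then show "val {#X, Y i#} mod m = (p + 2 + i) mod m" using t[of "p + 2 + i" m] by (simp only:)
qed

text \<open>\<open>Suc z\<close> is a multiple of \<open>m\<close>, so each \<open>Z\<close> counts
  as \<open>-1\<close>.\<close>

lemma val_mod_Z:
  assumes "j \<le> a"
  shows "val (replicate_mset j Z) mod m = (if j = 0 then 0 else m - j)"
proof (cases "j = 0")
  case False
  have jm: "j < m" using assms p_less by (simp add: m_def)
  have "j * Suc z = (2 * K * j) * m" unfolding Suc_z by simp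
  moreover have "1 \<le> 2 * K * j" using False p_less by simp
  then have "(2 * K * j) * m = (2 * K * j - 1) * m + m" by (simp add: diff_mult_distrib)
  ultimately have "j * z = (2 * K * j - 1) * m + (m - j)" using jm by simp
  moreover have "((2 * K * j - 1) * m + (m - j)) mod m = m - j"
    using False jm by (subst mod_mult_self3) simp
  ultimately show ?thesis using False by simp
qed simp

lemma replicate_if_only_Z:
  assumes "\<And>x. x \<in># A \<Longrightarrow> x = Z"
  shows "A = replicate_mset (size A) Z"
  using assms by (induction A) auto

end

text \<open>The index set with \<open>i \<le> j\<close> names each unordered pair once, so that
  counting is a sum over \<open>j\<close>.\<close>

definition level_pairs :: "nat \<Rightarrow> gen multiset set" where
  "level_pairs p = (\<lambda>(j, i). {#Y i, Y j#}) ` (SIGMA j:{1..p}. {1..j})"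

lemma level_pairs_iff:
  "A \<in> level_pairs p \<longleftrightarrow> (\<exists>i j. 1 \<le> i \<and> i \<le> p \<and> 1 \<le> j \<and> j \<le> p \<and> A = {#Y i, Y j#})"
proof
  assume "\<exists>i j. 1 \<le> i \<and> i \<le> p \<and> 1 \<le> j \<and> j \<le> p \<and> A = {#Y i, Y j#}"
  then obtain i j where ij: "1 \<le> i" "i \<le> p" "1 \<le> j" "j \<le> p" "A = {#Y i, Y j#}" by blast
  have "A = (\<lambda>(j, i). {#Y i, Y j#}) (max i j, min i j)"
    using ij by (auto simp: max_def min_def add_mset_commute)
  then show "A \<in> level_pairs p"
    unfolding level_pairs_def by (rule image_eqI) (use ij in auto)
qed (force simp: level_pairs_def)

lemma finite_level_pairs: "finite (level_pairs p)"
  by (simp add: level_pairs_def)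

lemma card_level_pairs: "2 * card (level_pairs p) = p * (p + 1)"
proof -
  have "inj_on (\<lambda>(j, i). {#Y i, Y j#}) (SIGMA j:{1..p}. {1..j})"
    by (auto simp: inj_on_def add_eq_conv_ex)
  then have "card (level_pairs p) = (\<Sum>j=1..p. j)"
    by (simp add: level_pairs_def card_image)
  moreover have "2 * (\<Sum>j=1..p. j) = p * (p + 1)" by (induction p) auto
  ultimately show ?thesis by simp
qed

section \<open>Semigroups without the atom \<open>X\<close>, for \<open>s = 0\<close>\<close>

locale plain_family = gen_family p K a False for p K a +
  assumes K_eq: "K = Suc p"
begin

definition N :: "gen multiset set" where
  "N = (\<lambda>j. replicate_mset j Z) ` {..a} \<union> (\<lambda>i. {#Y i#}) ` {1..p}"

definition I :: "gen multiset set" where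
  "I = level_pairs p \<union> (\<lambda>i. {#Y i, Z#}) ` {1..p} \<union> {replicate_mset (Suc a) Z}"

lemma I_cases:
  assumes "A \<in> I"
  obtains i j where "1 \<le> i" "i \<le> p" "1 \<le> j" "j \<le> p" "A = {#Y i, Y j#}"
    | i where "1 \<le> i" "i \<le> p" "A = {#Y i, Z#}"
    | "A = replicate_mset (Suc a) Z"
  using assms by (auto simp: I_def level_pairs_iff)

lemma I_reducible:
  assumes "A \<in> I"
  shows "reducible (val A)"
proof -
  from assms show ?thesis
  proof (cases rule: I_cases)
    case (1 i j)
    show ?thesis
    \<comment> \<open>Up to \<open>p\<close> copies of \<open>d\<close> the two \<open>m^2\<close>
      suffice; beyond that \<open>i + j \<ge> K\<close> and the residue wraps around.\<close>
    proof (cases "i + j \<le> p")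
      case True
      then show ?thesis using reducible_low[of "i + j" 2] by (simp add: 1 val_YY del: val_simps)
    next
      case False
      then have "K + (i + j - K) = i + j" "i + j - K \<le> p + 1" using 1 K_eq by auto
      then show ?thesis using reducible_wrap[of "i + j - K" 2] unfolding 1(5) val_YY by simp
    qed
  next
    case 2
    then show ?thesis using reducible_YZ by simp
  next
    case 3
    \<comment> \<open>One of the two \<open>m^2\<close> in \<open>val_chain\<close> goes into
      \<open>Y p\<close>. The other, written as \<open>m + m + q m\<close>, pays for the
      \<open>m\<close> added there and leaves an explicit \<open>M\<close>.\<close>
    obtain q where q: "m = 2 + q" using m_ge le_Suc_ex[of 2 m] by auto
    have "val A + m = p * d + 2 * (m * m)" using val_chain 3 K_eq by (simp del: val_simps)
    moreover have "m * m = m + m + q * m" using q by (simp add: algebra_simps)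
    ultimately have "val A = w M + val (add_mset (Y p) (replicate_mset q M))" by simp
    then show ?thesis by (rule reducibleI[rotated]) (use p_pos in simp)
  qed
qed

sublocale apery_presentation J M w N "{}" I
proof
  show "finite (- semigroup)" by (rule cofinite_semigroup)
  show "N \<subseteq> F" by (auto simp: N_def)
  show "finite I" by (simp add: I_def finite_level_pairs)
  show "I \<subseteq> F" by (auto simp: I_def level_pairs_iff)
  show "{} \<subseteq> N" by simp
  have "A \<notin> N" if "A \<in> I" for A
    using that by (auto simp: I_def N_def level_pairs_iff replicate_mset_eq_simps)
  then show "I \<inter> N = {}" by blast
  show "M \<notin># A" if "A \<in> I" for A
    using that by (auto simp: I_def level_pairs_iff split: if_splits)
  show "reducible (val A) \<or> (\<exists>B\<in>{}. val B = val A)" if "A \<in> I" for A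
    using I_reducible that by blast
  have chain_N: "replicate_mset a Z \<in> N" by (simp add: N_def)
  show gens_N: "{#j#} \<in> N - {}" if "j \<in> J" "j \<noteq> M" for j
    using that a_pos by (cases j) (auto simp: N_def intro!: image_eqI[of _ _ 1])
  show "A - {#x#} \<in> N - {}" if "A \<in> I" "x \<in># A" for A x
    using that by (cases rule: I_cases) (use chain_N gens_N in \<open>auto split: if_splits\<close>)
  show "A = B" if AB: "A \<in> N" "B \<in> N" and mod: "val A mod w M = val B mod w M" for A B
  proof -
    \<comment> \<open>\<open>f\<close> recovers a member of \<open>N\<close> from its
      residue.\<close>
    define f where "f t = (if t = 0 then {#} else if t \<le> p then {#Y t#}
      else replicate_mset (m - t) Z)" for t
    have m: "p + a < m" using m_def K_eq by linarith
    have "A = f (val A mod m)" if "A \<in> N" for A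
    proof -
      from that consider j where "j \<le> a" "A = replicate_mset j Z"
        | i where "1 \<le> i" "i \<le> p" "A = {#Y i#}" by (auto simp: N_def)
      then show ?thesis
        by cases (use m in \<open>auto simp: f_def val_mod val_mod_Z simp del: val_simps\<close>)
    qed
    then show ?thesis using AB mod by (metis w.simps(1))
  qed
  show "A \<in> I \<or> A \<in> N \<or> tied A" if A: "A \<in> F" for A
  proof (rule ccontr)
    assume contr: "\<not> ?thesis"
    \<comment> \<open>A proper superset of a member of \<open>I\<close> is tied, so \<open>A\<close>
      contains no member of \<open>I\<close>. It contains no \<open>M\<close> either, which forces
      it into \<open>N\<close>.\<close>
    have no_sub: "\<not> V \<subseteq># A" if "V \<in> I" for V
      using tied_superset[OF I_reducible[OF that], of A] that A contr by auto
    have M: "M \<notin># A" using contr tied_if_mem by blast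
    show False
    proof (cases "\<exists>i. Y i \<in># A")
      case True
      then obtain i A' where A': "A = add_mset (Y i) A'" by (meson multi_member_split)
      show False
      proof (cases A')
        case empty
        then show False using A A' contr by (auto simp: N_def)
      next
        case (add x A'')
        then have "{#Y i, x#} \<notin> I" using no_sub[of "{#Y i, x#}"] A' by auto
        then show False using A M A' add by (cases x) (auto simp: I_def level_pairs_iff)
      qed
    next
      case False
      then have "x = Z" if "x \<in># A" for x
        using A M that by (cases x) (auto simp: factorizations_def)
      then have eq: "A = replicate_mset (size A) Z" by (rule replicate_if_only_Z)
      show False
      proof (cases "size A \<le> a")
        case True
        then show False using eq contr by (auto simp: N_def)
      next
        case False
        then have "replicate_mset (Suc a) Z \<subseteq># A" by (subst eq) (auto simp: subseteq_mset_def)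
        then show False using no_sub[of "replicate_mset (Suc a) Z"] by (auto simp: I_def)
      qed
    qed
  qed
qed

text \<open>The sums of two of the \<open>p + 1\<close> atoms other than \<open>M\<close> are
  counted, with \<open>(a + 1) z\<close> in place of \<open>2 z\<close>.\<close>

lemma card_I: "card I = (p + 2) choose 2"
proof -
  have "card ((\<lambda>i. {#Y i, Z#}) ` {1..p}) = p" by (simp add: card_image inj_on_def)
  moreover have "level_pairs p \<inter> (\<lambda>i. {#Y i, Z#}) ` {1..p} = {}"
    by (auto simp: level_pairs_iff add_eq_conv_ex replicate_mset_eq_simps)
  moreover have "replicate_mset (Suc a) Z \<notin> level_pairs p \<union> (\<lambda>i. {#Y i, Z#}) ` {1..p}"
    by (auto simp: level_pairs_iff add_eq_conv_ex replicate_mset_eq_simps)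
  ultimately have "card I = card (level_pairs p) + p + 1"
    by (simp add: I_def card_Un_disjoint finite_level_pairs)
  then have "2 * card I = (p + 2) * (p + 1)" using card_level_pairs[of p] by simp
  then show ?thesis by (simp add: choose_two)
qed

end

section \<open>Semigroups with the atom \<open>X\<close>, for \<open>s = k + 1\<close>\<close>

locale cross_family = gen_family p K a True for p K a +
  fixes k :: nat
  assumes K_eq: "K = p + 3 + k" and k_le: "k \<le> p"
begin

definition N :: "gen multiset set" where
  "N = (\<lambda>j. replicate_mset j Z) ` {..a} \<union> (\<lambda>i. {#Y i#}) ` {1..p} \<union> {{#X#}, {#X, Z#}}
     \<union> (\<lambda>i. {#X, Y i#}) ` {1..k}"

definition I :: "gen multiset set" where
  "I = level_pairs p \<union> (\<lambda>i. {#Y i, Z#}) ` {1..p} \<union> (\<lambda>i. {#X, Y i#}) ` {Suc k..p}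
     \<union> {{#X, X#}, replicate_mset (Suc a) Z}"

lemma val_XZ: "val {#X, Z#} = (p + 1) * d + 2 * (m * m)"
  using z_add_d by simp

lemma I_cases:
  assumes "A \<in> I"
  obtains i j where "1 \<le> i" "i \<le> p" "1 \<le> j" "j \<le> p" "A = {#Y i, Y j#}"
    | i where "1 \<le> i" "i \<le> p" "A = {#Y i, Z#}"
    | i where "k < i" "i \<le> p" "A = {#X, Y i#}"
    | "A = {#X, X#}" | "A = replicate_mset (Suc a) Z"
  using assms by (auto simp: I_def level_pairs_iff)

lemma reducible_XX: "reducible (val {#X, X#})"
proof -
  have "K + (p + 1 - k) = 2 * (p + 2)" using k_le by (simp add: K_eq)
  then have "val {#X, X#} = (K + (p + 1 - k)) * d + 0 * (m * m)" by simp
  then show ?thesis using reducible_wrap[of "p + 1 - k" 0] by (simp only:)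
qed

text \<open>The exception is \<open>i + j = p + 1\<close>, where the pair is a further factorization
  of the Apery element \<open>X + Z\<close>.\<close>

lemma I_reducible:
  assumes "A \<in> I"
  shows "reducible (val A) \<or> val A = val {#X, Z#} \<and> (\<exists>i j. A = {#Y i, Y j#})"
  using assms
proof (cases rule: I_cases)
  case (1 i j)
  consider "i + j \<le> p" | "i + j = p + 1" | "i + j \<ge> p + 2" by linarith
  then show ?thesis
  proof cases
    case 1
    then show ?thesis using reducible_low[of "i + j" 2] by (simp add: \<open>A = _\<close> val_YY del: val_simps)
  next
    case 2
    then show ?thesis using val_XZ val_YY[of i j] \<open>A = _\<close> by (simp only:) blast
  next
    case 3
    \<comment> \<open>\<open>X\<close> absorbs \<open>p + 2\<close> copies of \<open>d\<close>, and
      the remaining \<open>t d + 2 m^2\<close> is reducible by itself.\<close>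
    then obtain t where t: "i + j = p + 2 + t" using le_Suc_ex by blast
    then have "t \<le> p" using 1 by simp
    moreover have "val A = val {#X#} + (t * d + 2 * (m * m))"
      unfolding \<open>A = _\<close> val_YY t by (simp add: algebra_simps)
    ultimately show ?thesis using reducible_add[OF reducible_low[of t 2], of "{#X#}"] by simp
  qed
next
  case (2 i)
  then show ?thesis using reducible_YZ by blast
next
  case (3 i)
  \<comment> \<open>The condition \<open>i > k\<close> is exactly where \<open>p + 2 + i\<close>
    reaches \<open>K\<close>.\<close>
  then have "K + (i - Suc k) = p + 2 + i" by (simp add: K_eq)
  then have "val A = (K + (i - Suc k)) * d + 1 * (m * m)" using 3 by (simp add: algebra_simps)
  then show ?thesis using reducible_wrap[of "i - Suc k" 1] 3(2) by (simp del: val_simps)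
next
  case 4
  then show ?thesis using reducible_XX by simp
next
  case 5
  obtain q where q: "m = 2 + q" using m_ge le_Suc_ex[of 2 m] by auto
  have mm: "m * m = m + m + q * m" using q by (simp add: algebra_simps)
  have "val A + m = (p + 2) * d + k * d + 2 * (m * m)" 
    using val_chain 5 K_eq by (simp add: distrib_right del: val_simps)
  show ?thesis
  \<comment> \<open>There is no \<open>Y 0\<close>, so for \<open>k = 0\<close> the
    \<open>m^2\<close> meant for \<open>Y k\<close> becomes further copies of
    \<open>M\<close>.\<close>
  proof (cases "k = 0")
    case True
    then have "val A = w M + val (add_mset X (replicate_mset (m + q) M))"
      using \<open>val A + m = _\<close> mm by (simp add: algebra_simps)
    then have "reducible (val A)" by (rule reducibleI[rotated]) simp
    then show ?thesis ..
  next
    case False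
    have "val A = w M + val (add_mset X (add_mset (Y k) (replicate_mset q M)))"
      using \<open>val A + m = _\<close> mm by (simp add: algebra_simps)
    then have "reducible (val A)" by (rule reducibleI[rotated]) (use False k_le in simp)
    then show ?thesis ..
  qed
qed

text \<open>\<open>X + Z\<close> lies in the Apery set, so \<open>tied_add\<close> cannot start from
  it. An extra \<open>X\<close> or \<open>Y i\<close> completes a reducible pair
  \<open>X + X\<close> or \<open>Y i + Z\<close> instead.\<close>

lemma tied_XZ:
  assumes "W \<in> F" "W \<noteq> {#}"
  shows "tied ({#X, Z#} + W)"
proof -
  obtain x W' where W: "W = add_mset x W'" using assms(2) by (meson multiset_cases)
  then have x: "x \<in> J" "W' \<in> F" using assms by auto
  show ?thesis
  proof (cases x)
    case M
    then show ?thesis using W by (intro tied_if_mem) auto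
  next
    case X
    then show ?thesis using tied_add[OF reducible_XX, of "add_mset Z W'"] W x
      by (simp add: add_mset_commute)
  next
    case (Y i)
    then show ?thesis using tied_add[OF reducible_YZ[of i], of "add_mset X W'"] W x
      by (simp add: add_mset_commute)
  next
    case Z
    \<comment> \<open>For a second \<open>Z\<close>, exchanging \<open>X + Z\<close> for
      \<open>Y 1 + Y p\<close> creates the reducible pair \<open>Y 1 + Z\<close>, while
      \<open>W\<close> stays shared.\<close>
    have "({#X, Z#} + W, {#Y 1, Y p#} + W) \<in> link"
      using assms p_pos val_XZ val_YY[of 1 p] by (intro link_exchange) (auto simp del: val_simps)
    moreover have "tied ({#Y 1, Y p#} + W)"
      using tied_add[OF reducible_YZ[of 1], of "add_mset (Y p) W'"] W x Z p_pos
      by (simp add: add_mset_commute)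
    ultimately show ?thesis by (rule tied_step)
  qed
qed

text \<open>A \<open>V\<close> of irreducible value can be exchanged for \<open>X + Z\<close>, after
  which \<open>tied_XZ\<close> applies.\<close>

lemma I_superset:
  assumes "V \<in> I" "V \<subseteq># A" "A \<in> F"
  shows "A = V \<or> tied A"
proof (cases "reducible (val V)")
  case True
  then show ?thesis using tied_superset assms by blast
next
  case False
  then have V: "val V = val {#X, Z#}" using I_reducible assms by blast
  obtain W where W: "A = V + W" using assms(2) by (metis subset_mset.le_iff_add)
  show ?thesis
  proof (cases "W = {#}")
    case False
    then have "(V + W, {#X, Z#} + W) \<in> link" using V W assms by (intro link_exchange) auto
    then show ?thesis using tied_step tied_XZ[of W] False W assms by auto
  qed (simp add: W)
qed

sublocale apery_presentation J M w N "{{#X, Z#}}" I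
proof
  show "finite (- semigroup)" by (rule cofinite_semigroup)
  show "N \<subseteq> F" using k_le by (auto simp: N_def)
  show "finite I" by (simp add: I_def finite_level_pairs)
  show "I \<subseteq> F" by (auto simp: I_def level_pairs_iff)
  show "{{#X, Z#}} \<subseteq> N" by (simp add: N_def)
  have "A \<notin> N" if "A \<in> I" for A
    using that by (cases rule: I_cases) (auto simp: N_def add_eq_conv_ex replicate_mset_eq_simps)
  then show "I \<inter> N = {}" by blast
  show "M \<notin># A" if "A \<in> I" for A using that by (cases rule: I_cases) auto
  show "reducible (val A) \<or> (\<exists>B\<in>{{#X, Z#}}. val B = val A)" if "A \<in> I" for A
    using I_reducible[OF that] by auto
  have chain_N: "replicate_mset a Z \<in> N - {{#X, Z#}}"
    by (auto simp: N_def replicate_mset_eq_simps)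
  show gens_N: "{#j#} \<in> N - {{#X, Z#}}" if "j \<in> J" "j \<noteq> M" for j
    using that a_pos by (cases j) (auto simp: N_def intro!: image_eqI[of _ _ 1])
  show "A - {#x#} \<in> N - {{#X, Z#}}" if "A \<in> I" "x \<in># A" for A x
    using that by (cases rule: I_cases) (use chain_N gens_N in \<open>auto split: if_splits\<close>)
  show "A = B" if AB: "A \<in> N" "B \<in> N" and mod: "val A mod w M = val B mod w M" for A B
  proof -
    \<comment> \<open>By increasing residue, \<open>N\<close> consists of \<open>0\<close>, the
      \<open>Y t\<close>, \<open>X + Z\<close>, \<open>X\<close>, the \<open>X + Y i\<close>, and
      the multiples of \<open>z\<close> in descending order.\<close>
    define f where "f t = (if t = 0 then {#} else if t \<le> p then {#Y t#}
      else if t = p + 1 then {#X, Z#} else if t = p + 2 then {#X#}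
      else if t \<le> p + 2 + k then {#X, Y (t - p - 2)#} else replicate_mset (m - t) Z)" for t
    have m: "p + 2 + k + a < m" using m_def K_eq by linarith
    have "A = f (val A mod m)" if "A \<in> N" for A
    proof -
      from that consider j where "j \<le> a" "A = replicate_mset j Z"
        | i where "1 \<le> i" "i \<le> p" "A = {#Y i#}" | "A = {#X#}" | "A = {#X, Z#}"
        | i where "1 \<le> i" "i \<le> k" "A = {#X, Y i#}" by (auto simp: N_def)
      then show ?thesis
        by cases (use m in \<open>auto simp: f_def val_mod val_mod_Z simp del: val_simps\<close>)
    qed
    then show ?thesis using AB mod by (metis w.simps(1))
  qed
  show "A \<in> I \<or> A \<in> N \<or> tied A" if A: "A \<in> F" for A
  proof (rule ccontr)
    assume contr: "\<not> ?thesis"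
    have no_sub: "\<not> V \<subseteq># A" if "V \<in> I" for V
      using I_superset[OF that, of A] that A contr by auto
    have pair: "{#x, y#} \<notin> I" if "A = add_mset x (add_mset y B)" for x y B
      using no_sub[of "{#x, y#}"] that by auto
    have M: "M \<notin># A" using contr tied_if_mem by blast
    consider i where "Y i \<in># A" | "X \<in># A" "\<And>i. Y i \<notin># A" | "\<And>x. x \<in># A \<Longrightarrow> x = Z"
      using M by (metis gen.exhaust)
    then show False
    proof cases
      case 1
      then obtain A' where A': "A = add_mset (Y i) A'" by (meson multi_member_split)
      show False
      proof (cases A')
        case empty
        then show False using A A' contr by (auto simp: N_def)
      next
        case (add x B)
        then have x: "x = X" using pair[of "Y i" x B] A M A'
          by (cases x) (auto simp: I_def level_pairs_iff)
        then have i: "i \<le> k" using pair[of X "Y i" B] A A' add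
          by (auto simp: I_def add_mset_commute)
        show False
        proof (cases B)
          case empty
          then show False using A A' add x i contr by (auto simp: N_def add_mset_commute)
        next
          case (add y B')
          \<comment> \<open>Whatever the third atom \<open>y\<close> is, it forms a member of
            \<open>I\<close> with \<open>Y i\<close> or with \<open>X\<close>.\<close>
          then have "A = add_mset (Y i) (add_mset y (add_mset X B'))"
            "A = add_mset X (add_mset y (add_mset (Y i) B'))"
            using A' \<open>A' = _\<close> x by (auto simp: add_mset_commute)
          then have "{#Y i, y#} \<notin> I" "{#X, y#} \<notin> I" "y \<in> J" "y \<noteq> M" "i \<le> p" "1 \<le> i"
            using pair A M by (auto simp: add_mset_commute)
          then show False by (cases y) (auto simp: I_def level_pairs_iff)
        qed
      qed
    next
      case 2
      then obtain A' where A': "A = add_mset X A'" by (meson multi_member_split)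
      show False
      proof (cases A')
        case empty
        then show False using A' contr by (auto simp: N_def)
      next
        case (add x B)
        then have "x = Z" using pair[of X x B] A M A' 2
          by (cases x) (auto simp: I_def level_pairs_iff)
        then have eq: "A = {#X, Z#} + B" using A' add by simp
        then show False using tied_XZ[of B] A contr by (cases "B = {#}") (auto simp: N_def)
      qed
    next
      case 3
      then have eq: "A = replicate_mset (size A) Z" by (rule replicate_if_only_Z)
      show False
      proof (cases "size A \<le> a")
        case True
        then show False using eq contr by (auto simp: N_def)
      next
        case False
        then have "replicate_mset (Suc a) Z \<subseteq># A" by (subst eq) (auto simp: subseteq_mset_def)
        then show False using no_sub[of "replicate_mset (Suc a) Z"] by (auto simp: I_def)
      qed
    qed
  qed
qed

text \<open>Among the sums of two of the \<open>p + 2\<close> atoms other than \<open>M\<close>,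
  exactly \<open>X + Z\<close> and \<open>X + Y i\<close> with \<open>i \<le> k\<close> are missing,
  and \<open>(a + 1) z\<close> stands for \<open>2 z\<close>.\<close>

lemma card_I: "card I + Suc k = (p + 3) choose 2"
proof -
  let ?A = "(\<lambda>i. {#Y i, Z#}) ` {1..p}" and ?B = "(\<lambda>i. {#X, Y i#}) ` {Suc k..p}"
  have "card ?A = p" "card ?B = p - k" by (simp_all add: card_image inj_on_def)
  moreover have "level_pairs p \<inter> ?A = {}" "(level_pairs p \<union> ?A) \<inter> ?B = {}"
    by (auto simp: level_pairs_iff add_eq_conv_ex replicate_mset_eq_simps)
  moreover have "{#X, X#} \<notin> level_pairs p \<union> ?A \<union> ?B"
    "replicate_mset (Suc a) Z \<notin> level_pairs p \<union> ?A \<union> ?B" "{#X, X#} \<noteq> replicate_mset (Suc a) Z"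
    by (auto simp: level_pairs_iff add_eq_conv_ex replicate_mset_eq_simps)
  moreover have "I = insert {#X, X#} (insert (replicate_mset (Suc a) Z) (level_pairs p \<union> ?A \<union> ?B))"
    by (auto simp: I_def)
  ultimately have "card I = card (level_pairs p) + p + (p - k) + 2"
    by (simp add: card_Un_disjoint finite_level_pairs card_insert_if)
  then have "2 * (card I + Suc k) = (p + 3) * (p + 2)" using card_level_pairs[of p] k_le
    by (simp add: algebra_simps)
  then show ?thesis by (simp add: choose_two)
qed

end

section \<open>Choice of the parameters from \<open>e\<close>, \<open>r\<close> and
  \<open>s\<close>\<close>

theorem theorem4p2:
  fixes e r s :: nat
  assumes "e \<ge> 4" and "s \<le> min (e - 2) r"
  shows "\<exists>S. numerical_semigroup S \<and> embedding_dim S = e \<and>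
             semigroup_multiplicity S = r + e \<and>
             int (eta S) = int (e choose 2) - int s"
proof (cases s)
  case 0
  \<comment> \<open>Besides \<open>M\<close> and \<open>Z\<close> there are \<open>p = e - 2\<close>
    atoms \<open>Y i\<close>; with \<open>K = p + 1\<close>, the multiplicity \<open>r + e\<close>
    forces \<open>a = r + 1\<close>.\<close>
  interpret plain_family "e - 2" "e - Suc 0" "Suc r" using assms by unfold_locales auto
  have "embedding_dim semigroup = e" using embedding_dim card_J assms by simp
  moreover have "semigroup_multiplicity semigroup = r + e"
    using multiplicity assms by (simp add: m_def)
  moreover have "eta semigroup = e choose 2"
    using eta card_I le_add_diff_inverse2[of 2 e] assms by simp
  ultimately show ?thesis using numerical_semigroup 0 by auto
next
  case (Suc k)
  \<comment> \<open>Here \<open>p = e - 3\<close> and \<open>K = p + 3 + k = e + k\<close>, so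
    \<open>m = r + e\<close> forces \<open>a = r - k\<close>. Then \<open>a \<ge> 1\<close> amounts
    to \<open>s \<le> r\<close>, and \<open>k \<le> p\<close> to
    \<open>s \<le> e - 2\<close>.\<close>
  interpret cross_family "e - 3" "e + k" "r - k" k using assms Suc by unfold_locales auto
  have "embedding_dim semigroup = e" using embedding_dim card_J assms by simp
  moreover have "semigroup_multiplicity semigroup = r + e"
    using multiplicity assms Suc by (simp add: m_def)
  moreover have "eta semigroup + s = e choose 2"
    using eta card_I le_add_diff_inverse2[of 3 e] assms Suc by simp
  ultimately show ?thesis using numerical_semigroup by (intro exI[of _ semigroup]) linarith
qed

end
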